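(* Let $\langle M,\sqsubseteq\rangle$ be a model of set-theoretic mereology. Then $\langle M,\sqsubseteq\rangle$ is $\omega$-saturated if and only if both (1) every infinite element of $M$ is the join of two disjoint infinite elements, and (2) for every element $a\in M$ there is an infinite element $u\in M$ disjoint from $a$. Equivalently, $\langle M,\sqsubseteq\rangle$ is $\omega$-saturated if and only if there are infinite elements and for every infinite element $u$ there is an element $x$ for which $u-x$, $u\cap x$ and $x-u$ are each infinite.
   Context: A model of set-theoretic mereology is a structure $\langle M,\sqsubseteq\rangle$ in which $\sqsubseteq$ is an unbounded (no largest element) atomic relatively complemented distributive lattice order; $\cup,\cap,-$ denote join, meet, and relative complement, and two elements are disjoint if their meet is the least element. An element $u\in M$ is called infinite if it is not the join of finitely many atoms (equivalently, infinitely many atoms lie below it). $\omega$-saturated means every 1-type over finitely many parameters from $M$ that is finitely satisfiable in $M$ is realized in $M$. *)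

theory Defs
  imports "HOL-Library.Lub_Glb"
begin

section \<open>Models of set-theoretic mereology\<close>

definition (in order_bot) atom :: "'a \<Rightarrow> bool" where
  "atom a \<longleftrightarrow> a \<noteq> bot \<and> (\<forall>x. x \<le> a \<longrightarrow> x = bot \<or> x = a)"

text \<open>The universe of the model is the type itself. The operations \<open>inf\<close>, \<open>sup\<close>, \<open>bot\<close> and \<open>-\<close>
  are all determined by the order.\<close>

class set_mereology = distrib_lattice + bounded_lattice_bot + minus +
  assumes no_largest: "\<not> (\<exists>t. \<forall>x. x \<le> t)"
    and atomic: "x \<noteq> bot \<Longrightarrow> \<exists>a. atom a \<and> a \<le> x"
    and inf_diff: "inf (x - y) y = bot"
    and sup_diff: "sup (inf x y) (x - y) = x"

text \<open>The empty join is allowed: \<^term>\<open>bot\<close> is the least upper bound of \<^term>\<open>{}\<close>, so it is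
  not infinite.\<close>

definition infinite_elem :: "'a::order_bot \<Rightarrow> bool" where
  "infinite_elem u \<longleftrightarrow> \<not> (\<exists>A. finite A \<and> (\<forall>a\<in>A. atom a) \<and> isLub UNIV A u)"

definition disjoint_elem :: "'a::bounded_lattice_bot \<Rightarrow> 'a \<Rightarrow> bool" where
  "disjoint_elem x y \<longleftrightarrow> inf x y = bot"


section \<open>Saturation\<close>

text \<open>First-order formulas with equality in the language of one binary relation symbol, with
  parameters from \<^typ>\<open>'a\<close> serving as names for themselves.\<close>

datatype 'a trm = Var nat | Par 'a

datatype 'a fm =
    Rel "'a trm" "'a trm"
  | Equal "'a trm" "'a trm"
  | Neg "'a fm"
  | Conj "'a fm" "'a fm"
  | Exists nat "'a fm"

primrec vars_trm :: "'a trm \<Rightarrow> nat set" where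
  "vars_trm (Var n) = {n}"
| "vars_trm (Par a) = {}"

primrec free_vars :: "'a fm \<Rightarrow> nat set" where
  "free_vars (Rel s t) = vars_trm s \<union> vars_trm t"
| "free_vars (Equal s t) = vars_trm s \<union> vars_trm t"
| "free_vars (Neg \<phi>) = free_vars \<phi>"
| "free_vars (Conj \<phi> \<psi>) = free_vars \<phi> \<union> free_vars \<psi>"
| "free_vars (Exists n \<phi>) = free_vars \<phi> - {n}"

text \<open>The parameters occurring in a formula are given by the generated function
  \<^term>\<open>set_fm\<close>.\<close>

primrec val :: "(nat \<Rightarrow> 'a) \<Rightarrow> 'a trm \<Rightarrow> 'a" where
  "val e (Var n) = e n"
| "val e (Par a) = a"

primrec sat :: "('a \<Rightarrow> 'a \<Rightarrow> bool) \<Rightarrow> (nat \<Rightarrow> 'a) \<Rightarrow> 'a fm \<Rightarrow> bool" where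
  "sat R e (Rel s t) \<longleftrightarrow> R (val e s) (val e t)"
| "sat R e (Equal s t) \<longleftrightarrow> val e s = val e t"
| "sat R e (Neg \<phi>) \<longleftrightarrow> \<not> sat R e \<phi>"
| "sat R e (Conj \<phi> \<psi>) \<longleftrightarrow> sat R e \<phi> \<and> sat R e \<psi>"
| "sat R e (Exists n \<phi>) \<longleftrightarrow> (\<exists>x. sat R (e(n := x)) \<phi>)"

definition one_type_over :: "'a set \<Rightarrow> 'a fm set \<Rightarrow> bool" where
  "one_type_over A p \<longleftrightarrow> (\<forall>\<phi>\<in>p. set_fm \<phi> \<subseteq> A \<and> free_vars \<phi> \<subseteq> {0})"

text \<open>Only variable 0 may be free in a 1-type, so evaluating it at \<open>x\<close> may use the assignment
  that is constantly \<open>x\<close>.\<close>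

definition realizes :: "('a \<Rightarrow> 'a \<Rightarrow> bool) \<Rightarrow> 'a \<Rightarrow> 'a fm set \<Rightarrow> bool" where
  "realizes R x p \<longleftrightarrow> (\<forall>\<phi>\<in>p. sat R (\<lambda>_. x) \<phi>)"

definition finitely_satisfiable :: "('a \<Rightarrow> 'a \<Rightarrow> bool) \<Rightarrow> 'a fm set \<Rightarrow> bool" where
  "finitely_satisfiable R p \<longleftrightarrow> (\<forall>q. finite q \<and> q \<subseteq> p \<longrightarrow> (\<exists>x. realizes R x q))"

definition omega_saturated :: "('a \<Rightarrow> 'a \<Rightarrow> bool) \<Rightarrow> bool" where
  "omega_saturated R \<longleftrightarrow>
     (\<forall>A p. finite A \<and> one_type_over A p \<and> finitely_satisfiable R p \<longrightarrow> (\<exists>x. realizes R x p))"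

end

theory Submission
  imports Defs "HOL-Library.FuncSet"
begin

text \<open>A tuple of elements divides the atoms into cells, and by an Ehrenfeucht-Fraisse argument two
  tuples whose cells have the same sizes up to the threshold \<open>2 ^ n\<close> satisfy the same formulas of
  quantifier rank \<open>n\<close>. Hence only finitely many classes of elements are distinguished at rank
  \<open>n\<close>, so a finitely satisfiable 1-type over finitely many parameters has, for each \<open>n\<close>, an
  element \<open>x n\<close> realizing its formulas of rank at most \<open>n\<close>. Along a suitable infinite set of
  indices, every cell of \<open>x n\<close> has constant finite size or grows beyond all bounds; the two
  splitting conditions provide an element with these limit sizes, which realizes the type.
  Conversely, the types saying that \<open>x\<close> and \<open>u - x\<close> (respectively \<open>x - a\<close>) have at least \<open>n\<close>
  atoms for every \<open>n\<close> are finitely satisfiable, and their realizations give the splitting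
  conditions.\<close>


section \<open>Elements as sets of atoms\<close>

definition atoms_below :: "'a::order_bot \<Rightarrow> 'a set" where
  "atoms_below x = {a. atom a \<and> a \<le> x}"

text \<open>Distributivity makes \<open>a\<close> the join of its meets with \<open>x\<close> and
  \<open>y\<close>. As \<open>a\<close> is an atom, either its meet with \<open>x\<close> is all of
  \<open>a\<close>, or that meet is \<open>bot\<close> and the one with \<open>y\<close> is
  \<open>a\<close>.\<close>

lemma atom_le_sup_iff:
  fixes a :: "'a::set_mereology"
  assumes "atom a"
  shows "a \<le> sup x y \<longleftrightarrow> a \<le> x \<or> a \<le> y"
proof
  assume "a \<le> sup x y"
  then have eq: "a = sup (inf a x) (inf a y)"
    by (metis inf.absorb1 inf_sup_distrib1)
  have "inf a x = bot \<or> inf a x = a"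
    using assms by (simp add: atom_def)
  with eq show "a \<le> x \<or> a \<le> y"
    by (metis inf.absorb_iff1 sup_bot_left)
qed (auto intro: le_supI1 le_supI2)

lemma atom_le_diff_iff:
  fixes a :: "'a::set_mereology"
  assumes "atom a"
  shows "a \<le> x - y \<longleftrightarrow> a \<le> x \<and> \<not> a \<le> y"
proof -
  have "a \<le> x \<longleftrightarrow> (a \<le> x \<and> a \<le> y) \<or> a \<le> x - y"
    using atom_le_sup_iff[OF assms, of "inf x y" "x - y"] by (simp add: sup_diff)
  moreover have "\<not> (a \<le> x - y \<and> a \<le> y)"
  proof
    assume "a \<le> x - y \<and> a \<le> y"
    then have "a \<le> inf (x - y) y" by simp
    then show False
      using assms by (simp add: inf_diff bot_unique atom_def)
  qed
  ultimately show ?thesis by blast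
qed

lemma atoms_below_sup [simp]:
  "atoms_below (sup x y) = atoms_below x \<union> atoms_below (y::'a::set_mereology)"
  by (auto simp: atoms_below_def atom_le_sup_iff)

lemma atoms_below_inf [simp]:
  "atoms_below (inf x y) = atoms_below x \<inter> atoms_below (y::'a::set_mereology)"
  by (auto simp: atoms_below_def)

lemma atoms_below_diff [simp]:
  "atoms_below (x - y) = atoms_below x - atoms_below (y::'a::set_mereology)"
  by (auto simp: atoms_below_def atom_le_diff_iff)

lemma atoms_below_bot [simp]: "atoms_below (bot::'a::order_bot) = {}"
  by (auto simp: atoms_below_def atom_def bot_unique)

lemma atoms_below_atom: "atom a \<Longrightarrow> atoms_below a = {a}"
  by (auto simp: atoms_below_def atom_def)

text \<open>If \<open>x - y\<close> were not \<open>bot\<close>, atomicity would give an atom below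
  \<open>x\<close> but not below \<open>y\<close>. Elements may thus be treated as sets of atoms
  from here on.\<close>

lemma le_iff_atoms_below:
  fixes x y :: "'a::set_mereology"
  shows "x \<le> y \<longleftrightarrow> atoms_below x \<subseteq> atoms_below y"
proof
  assume sub: "atoms_below x \<subseteq> atoms_below y"
  have "x - y = bot"
  proof (rule ccontr)
    assume "x - y \<noteq> bot"
    then obtain a where "atom a" "a \<le> x - y" using atomic by blast
    then have "a \<in> atoms_below (x - y)" by (simp add: atoms_below_def)
    with sub show False by auto
  qed
  then have "x = inf x y" using sup_diff[of x y] by simp
  then show "x \<le> y" by (metis inf.cobounded2)
qed (auto simp: atoms_below_def intro: order_trans)

lemma eq_iff_atoms_below:
  fixes x y :: "'a::set_mereology"
  shows "x = y \<longleftrightarrow> atoms_below x = atoms_below y"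
  by (auto simp: order_eq_iff le_iff_atoms_below)

lemma less_iff_atoms_below:
  fixes x y :: "'a::set_mereology"
  shows "x < y \<longleftrightarrow> atoms_below x \<subset> atoms_below y"
  by (auto simp: less_le le_iff_atoms_below eq_iff_atoms_below)

lemma disjoint_elem_iff:
  fixes x y :: "'a::set_mereology"
  shows "disjoint_elem x y \<longleftrightarrow> atoms_below x \<inter> atoms_below y = {}"
  by (simp add: disjoint_elem_def eq_iff_atoms_below)

lemma ex_atoms_below_finite:
  fixes F :: "'a::set_mereology set"
  assumes "finite F" "\<forall>a\<in>F. atom a"
  shows "\<exists>x. atoms_below x = F"
  using assms
proof (induction F)
  case empty
  show ?case using atoms_below_bot by blast
next
  case (insert a F)
  then obtain x where "atoms_below x = F" by auto
  then have "atoms_below (sup a x) = insert a F"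
    using insert.prems by (simp add: atoms_below_atom)
  then show ?case by blast
qed

lemma ex_atoms_below_UN:
  fixes B :: "'i \<Rightarrow> 'a::set_mereology set"
  assumes "finite I" "\<And>i. i \<in> I \<Longrightarrow> \<exists>y. atoms_below y = B i"
  shows "\<exists>x. atoms_below x = (\<Union>i\<in>I. B i)"
  using assms
proof (induction I)
  case empty
  show ?case using atoms_below_bot by (metis UN_empty)
next
  case (insert i I)
  obtain x y where "atoms_below x = (\<Union>i\<in>I. B i)" "atoms_below y = B i"
    using insert by (metis insertCI)
  then have "atoms_below (sup y x) = (\<Union>i\<in>insert i I. B i)" by simp
  then show ?case by blast
qed

text \<open>A finite set \<open>A\<close> of atoms has a join whose atoms are exactly
  \<open>A\<close>, and a least upper bound of \<open>A\<close> lies below it. Conversely, every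
  \<open>u\<close> is the least upper bound of its own atoms.\<close>

lemma infinite_elem_iff:
  fixes u :: "'a::set_mereology"
  shows "infinite_elem u \<longleftrightarrow> infinite (atoms_below u)"
proof -
  have "finite (atoms_below u)" if A: "finite A" "\<forall>a\<in>A. atom a" "isLub UNIV A u" for A
  proof -
    obtain x where x: "atoms_below x = A"
      using ex_atoms_below_finite[OF A(1,2)] by blast
    then have "isUb UNIV A x"
      by (auto simp: isUb_def setle_def atoms_below_def)
    then have "u \<le> x" using A(3) isLub_le_isUb by blast
    then show ?thesis using x A(1) by (metis finite_subset le_iff_atoms_below)
  qed
  moreover have "isLub UNIV (atoms_below u) u"
    unfolding isLub_def leastP_def isUb_def setle_def setge_def
    by (auto simp: le_iff_atoms_below[of u]) (auto simp: atoms_below_def)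
  moreover have "\<forall>a\<in>atoms_below u. atom a" by (simp add: atoms_below_def)
  ultimately show ?thesis unfolding infinite_elem_def by blast
qed

text \<open>Unboundedness enters here: if only finitely many atoms lay outside \<open>x\<close>,
  joining them to \<open>x\<close> would give a largest element.\<close>

lemma infinite_atoms_outside:
  fixes x :: "'a::set_mereology"
  shows "infinite ({a. atom a} - atoms_below x)"
proof
  assume "finite ({a. atom a} - atoms_below x)"
  then obtain z where z: "atoms_below z = {a. atom a} - atoms_below x"
    using ex_atoms_below_finite by blast
  have "\<forall>y. y \<le> sup x z"
    by (auto simp: le_iff_atoms_below z) (auto simp: atoms_below_def)
  then show False using no_largest by blast
qed


section \<open>Truncated cardinality\<close>

text \<open>Infinite sets get the value \<open>N\<close> explicitly, since \<open>card\<close> is 0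
  on them.\<close>

definition tcard :: "nat \<Rightarrow> 'a set \<Rightarrow> nat" where
  "tcard N X = (if finite X then min N (card X) else N)"

lemma tcard_le: "tcard N X \<le> N"
  by (simp add: tcard_def)

lemma tcard_eq_0_iff: "N > 0 \<Longrightarrow> tcard N X = 0 \<longleftrightarrow> X = {}"
  by (auto simp: tcard_def min_def)

lemma tcard_tcard: "M \<le> N \<Longrightarrow> tcard M X = min M (tcard N X)"
  by (auto simp: tcard_def)

lemma tcard_Un_disjoint:
  "X \<inter> Y = {} \<Longrightarrow> tcard N (X \<union> Y) = min N (tcard N X + tcard N Y)"
  by (auto simp: tcard_def card_Un_disjoint)

lemma tcard_eq_iff:
  "tcard N X = N \<longleftrightarrow> (finite X \<longrightarrow> N \<le> card X)"
  by (auto simp: tcard_def)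

lemma tcard_eq_ex_subset:
  assumes "k \<le> tcard N X"
  shows "\<exists>B\<subseteq>X. finite B \<and> card B = k"
proof (cases "finite X")
  case True
  then show ?thesis using assms obtain_subset_with_card_n[of k X]
    by (metis finite_subset min.boundedE tcard_def)
next
  case False
  then show ?thesis using infinite_arbitrarily_large[of X k] by blast
qed

text \<open>Below the threshold \<open>2 * N\<close> the sizes of \<open>X\<close> and
  \<open>Y\<close> are equal and finite. Otherwise both sets have at least \<open>2 * N\<close>
  elements, and removing at most \<open>N\<close> leaves at least \<open>N\<close>.\<close>

lemma tcard_diff_finite:
  assumes eq: "tcard (2 * N) X = tcard (2 * N) Y"
    and B: "finite B" "B \<subseteq> X" "card B \<le> N"
    and B': "finite B'" "B' \<subseteq> Y" "card B' = card B"
  shows "tcard N (Y - B') = tcard N (X - B)"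
proof -
  have 1: "card (X - B) = card X - card B" using B by (simp add: card_Diff_subset)
  have 2: "card (Y - B') = card Y - card B" using B' by (simp add: card_Diff_subset)
  show ?thesis
    using eq B B' by (auto simp: tcard_def 1 2 min_def split: if_splits)
qed

text \<open>The induction step of an Ehrenfeucht-Fraisse argument for one cell: halving the threshold
  leaves room to answer any splitting by one that is finite or cofinite.\<close>

lemma tcard_split:
  assumes eq: "tcard (2 * N) X = tcard (2 * N) Y" and "B \<subseteq> X"
  obtains B' where "B' \<subseteq> Y" "tcard N B' = tcard N B" "tcard N (Y - B') = tcard N (X - B)"
    "finite B' \<or> finite (X - B) \<and> finite (Y - B')"
proof -
  have small: "\<exists>D'\<subseteq>Y. finite D' \<and> tcard N D' = tcard N D \<and> tcard N (Y - D') = tcard N (X - D)"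
    if D: "finite D" "card D \<le> N" "D \<subseteq> X" for D
  proof -
    have "finite X \<Longrightarrow> card D \<le> card X" using D(3) by (rule card_mono[rotated])
    then have "card D \<le> tcard (2 * N) Y"
      using eq D(2) by (metis (no_types, lifting) le_add1 min.boundedI mult_2 order_trans tcard_def)
    then obtain D' where D': "D' \<subseteq> Y" "finite D'" "card D' = card D"
      using tcard_eq_ex_subset by blast
    moreover have "tcard N D' = tcard N D" using D(1) D'(2,3) by (simp add: tcard_def)
    ultimately show ?thesis
      using tcard_diff_finite[OF eq D(1,3,2) D'(2,1,3)] by blast
  qed
  consider "finite B" "card B \<le> N" | "finite (X - B)" "card (X - B) \<le> N"
    | "tcard N B = N" "tcard N (X - B) = N"
    unfolding tcard_eq_iff using nat_le_linear by blast
  then show thesis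
  proof cases
    case 1
    then show ?thesis using small[OF 1 \<open>B \<subseteq> X\<close>] that by blast
  next
    case 2
    \<comment> \<open>The small part is now \<open>X - B\<close>: answer it by \<open>D\<close> and
      take the complement of \<open>D\<close> in \<open>Y\<close>.\<close>
    obtain D where D: "D \<subseteq> Y" "finite D" "tcard N D = tcard N (X - B)"
      "tcard N (Y - D) = tcard N (X - (X - B))"
      using small[OF 2] by blast
    moreover have "X - (X - B) = B" "Y - (Y - D) = D" using \<open>B \<subseteq> X\<close> D(1) by auto
    ultimately show ?thesis using that[of "Y - D"] 2 by simp
  next
    case 3
    have "tcard (2 * N) X = 2 * N"
    proof -
      have "2 * N \<le> card X" if "finite X"
      proof -
        have "finite B" using that \<open>B \<subseteq> X\<close> finite_subset by blast
        then have "N \<le> card B" "N \<le> card (X - B)" using 3 that by (auto simp: tcard_eq_iff)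
        moreover have "card (X - B) = card X - card B"
          using \<open>finite B\<close> \<open>B \<subseteq> X\<close> by (rule card_Diff_subset)
        ultimately show ?thesis by linarith
      qed
      then show ?thesis by (simp add: tcard_eq_iff)
    qed
    then have Y: "tcard (2 * N) Y = 2 * N" using eq by simp
    \<comment> \<open>When both parts are large, exactly \<open>N\<close> elements of
      \<open>Y\<close> suffice, because at least \<open>N\<close> others remain.\<close>
    then obtain B' where B': "B' \<subseteq> Y" "finite B'" "card B' = N"
      using tcard_eq_ex_subset[of N "2 * N" Y] by auto
    have "tcard N (Y - B') = N"
      unfolding tcard_eq_iff using Y[unfolded tcard_eq_iff] B'
      by (auto simp: card_Diff_subset)
    then show ?thesis using that[of B'] B' 3 by (simp add: tcard_def)
  qed
qed


section \<open>Cells and elementary equivalence of tuples\<close>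

text \<open>The cell of \<^term>\<open>{}\<close> is the set of atoms outside all terms; it is not bounded by any
  element.\<close>

definition cell :: "'a trm set \<Rightarrow> (nat \<Rightarrow> 'a) \<Rightarrow> 'a trm set \<Rightarrow> 'a::set_mereology set" where
  "cell T e S = {a. atom a \<and> {t \<in> T. a \<le> val e t} = S}"

lemma cell_not_subset: "\<not> S \<subseteq> T \<Longrightarrow> cell T e S = {}"
  by (auto simp: cell_def)

lemma cell_disjoint: "S \<noteq> S' \<Longrightarrow> cell T e S \<inter> cell T e S' = {}"
  by (auto simp: cell_def)

lemma cell_cong:
  assumes "\<And>t. t \<in> T \<Longrightarrow> val e t = val e' t"
  shows "cell T e S = cell T e' S"
proof -
  have "{t \<in> T. a \<le> val e t} = {t \<in> T. a \<le> val e' t}" for a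
    using assms by auto
  then show ?thesis by (simp add: cell_def)
qed

lemma cell_insert:
  assumes "t \<notin> T"
  shows "cell (insert t T) e S =
    (if t \<in> S then cell T e (S - {t}) \<inter> atoms_below (val e t)
     else cell T e S - atoms_below (val e t))"
proof (rule set_eqI)
  fix a
  define P where "P = {s \<in> T. a \<le> val e s}"
  have "t \<notin> P" using assms by (simp add: P_def)
  moreover have eq: "{s \<in> insert t T. a \<le> val e s} = (if a \<le> val e t then insert t P else P)"
    by (auto simp: P_def)
  ultimately have "{s \<in> insert t T. a \<le> val e s} = S \<longleftrightarrow>
      (if t \<in> S then a \<le> val e t \<and> P = S - {t} else \<not> a \<le> val e t \<and> P = S)"
    unfolding eq by auto
  then show "a \<in> cell (insert t T) e S \<longleftrightarrow>
    a \<in> (if t \<in> S then cell T e (S - {t}) \<inter> atoms_below (val e t)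
     else cell T e S - atoms_below (val e t))"
    unfolding cell_def atoms_below_def P_def[symmetric]
    by (cases "t \<in> S") (simp_all only: mem_Collect_eq Int_iff Diff_iff if_True if_False P_def, argo+)
qed

text \<open>Being outside the terms and outside \<open>y\<close> means being outside one join. The
  induction therefore varies \<open>y\<close> and absorbs each new term into it.\<close>

lemma infinite_cell_outside:
  assumes "finite T"
  shows "infinite (cell T e {} - atoms_below y)"
  using assms
proof (induction T arbitrary: y)
  case empty
  show ?case using infinite_atoms_outside by (simp add: cell_def)
next
  case (insert t T)
  have "cell (insert t T) e {} - atoms_below y = cell T e {} - atoms_below (sup (val e t) y)"
    using insert.hyps by (auto simp: cell_insert)
  then show ?case using insert.IH by metis
qed

text \<open>With no largest element there are no absolute complements. Inside \<open>y\<close>,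
  relative complements replace them, so any cell cut down to \<open>y\<close> is the atom set of an
  element.\<close>

lemma ex_atoms_below_cell_Int:
  assumes "finite T"
  shows "\<exists>x. atoms_below x = cell T e S \<inter> atoms_below y"
  using assms
proof (induction T arbitrary: S y)
  case empty
  have "cell {} e S \<inter> atoms_below y = atoms_below (if S = {} then y else bot)"
    by (auto simp: cell_def atoms_below_def atom_def bot_unique)
  then show ?case by metis
next
  case (insert t T)
  have "cell (insert t T) e S \<inter> atoms_below y =
    (if t \<in> S then cell T e (S - {t}) \<inter> atoms_below (inf (val e t) y)
     else cell T e S \<inter> atoms_below (y - val e t))"
    using insert.hyps by (auto simp: cell_insert)
  then show ?case
    using insert.IH[of "S - {t}" "inf (val e t) y"] insert.IH[of S "y - val e t"]
    by (cases "t \<in> S") simp_all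
qed

text \<open>Any member of \<open>S\<close> that is a term of \<open>T\<close> bounds the cell, so
  the cut-down version already gives the whole cell.\<close>

lemma ex_atoms_below_cell:
  assumes "finite T" "S \<noteq> {}"
  shows "\<exists>x. atoms_below x = cell T e S"
proof (cases "S \<subseteq> T")
  case True
  obtain s where "s \<in> S" using assms by blast
  then have "cell T e S \<inter> atoms_below (val e s) = cell T e S"
    by (auto simp: cell_def atoms_below_def)
  then show ?thesis using ex_atoms_below_cell_Int[OF assms(1)] by metis
next
  case False
  then show ?thesis using atoms_below_bot by (metis cell_not_subset)
qed

text \<open>Cells are pairwise disjoint and finite in number, so choices made independently in each
  cell can be joined into one element without interfering.\<close>

lemma ex_glue_cells:
  assumes "finite T"
    and ex: "\<And>S. S \<subseteq> T \<Longrightarrow> \<exists>y. atoms_below y \<subseteq> cell T e S \<and> P S (atoms_below y)"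
  shows "\<exists>x. \<forall>S\<subseteq>T. P S (cell T e S \<inter> atoms_below x)"
proof -
  have "\<forall>S. \<exists>y. S \<subseteq> T \<longrightarrow> atoms_below y \<subseteq> cell T e S \<and> P S (atoms_below y)"
    using ex by blast
  from choice[OF this] obtain f
    where f: "\<And>S. S \<subseteq> T \<Longrightarrow> atoms_below (f S) \<subseteq> cell T e S"
      "\<And>S. S \<subseteq> T \<Longrightarrow> P S (atoms_below (f S))"
    by blast
  obtain x where x: "atoms_below x = (\<Union>S\<in>Pow T. atoms_below (f S))"
    using ex_atoms_below_UN[of "Pow T" "\<lambda>S. atoms_below (f S)"] \<open>finite T\<close> by blast
  have "cell T e S \<inter> atoms_below x = atoms_below (f S)" if "S \<subseteq> T" for S
  proof (intro equalityI subsetI)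
    fix a assume a: "a \<in> cell T e S \<inter> atoms_below x"
    then obtain S' where S': "S' \<subseteq> T" "a \<in> atoms_below (f S')" unfolding x by blast
    then have "S' = S" using f(1)[of S'] a cell_disjoint[of S S' T e] by blast
    then show "a \<in> atoms_below (f S)" using S' by simp
  qed (use f(1)[OF that] that in \<open>auto simp: x\<close>)
  then show ?thesis using f(2) by (intro exI[of _ x]) simp
qed

section \<open>Equivalence of tuples up to a threshold, and its back-and-forth property\<close>

definition cell_equiv ::
    "nat \<Rightarrow> 'a trm set \<Rightarrow> (nat \<Rightarrow> 'a) \<Rightarrow> (nat \<Rightarrow> 'a::set_mereology) \<Rightarrow> bool" where
  "cell_equiv N T e e' \<longleftrightarrow> (\<forall>S\<subseteq>T. tcard N (cell T e S) = tcard N (cell T e' S))"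

lemma cell_equivD: "cell_equiv N T e e' \<Longrightarrow> tcard N (cell T e S) = tcard N (cell T e' S)"
  by (cases "S \<subseteq> T") (auto simp: cell_equiv_def cell_not_subset)

lemma cell_equiv_sym: "cell_equiv N T e e' \<Longrightarrow> cell_equiv N T e' e"
  by (simp add: cell_equiv_def)

lemma cell_equiv_mono: "cell_equiv N T e e' \<Longrightarrow> M \<le> N \<Longrightarrow> cell_equiv M T e e'"
  by (simp add: cell_equiv_def tcard_tcard[of M N])

text \<open>Forgetting \<open>t\<close> merges two disjoint cells, and the truncated size of a
  disjoint union is determined by the truncated sizes of its parts.\<close>

lemma cell_equiv_remove:
  assumes "cell_equiv N T e e'"
  shows "cell_equiv N (T - {t}) e e'"
proof (cases "t \<in> T")
  case True
  let ?T = "T - {t}"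
  have eq: "cell ?T d S = cell T d S \<union> cell T d (insert t S)" if "S \<subseteq> ?T" for d S
    using cell_insert[of t ?T d S] cell_insert[of t ?T d "insert t S"] that True
    by (auto simp: insert_absorb)
  have "tcard N (cell ?T e S) = tcard N (cell ?T e' S)" if "S \<subseteq> ?T" for S
  proof -
    have "S \<noteq> insert t S" using that by blast
    then show ?thesis
      using eq[OF that] tcard_Un_disjoint[OF cell_disjoint, of S "insert t S"]
        cell_equivD[OF assms] by metis
  qed
  then show ?thesis by (simp add: cell_equiv_def)
qed (use assms in simp)

lemma cell_equiv_insert:
  assumes "finite T" "Var n \<notin> T"
    and "\<And>S. S \<subseteq> T \<Longrightarrow>
      tcard N (cell T e S \<inter> atoms_below (e n)) = tcard N (cell T e' S \<inter> atoms_below (e' n)) \<and>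
      tcard N (cell T e S - atoms_below (e n)) = tcard N (cell T e' S - atoms_below (e' n))"
  shows "cell_equiv N (insert (Var n) T) e e'"
  using assms(3) by (auto simp: cell_equiv_def cell_insert[OF assms(2)] subset_insert_iff)

lemma cell_equiv_extend:
  assumes "finite T" and equiv: "cell_equiv (2 * N) T e e'"
  shows "\<exists>x'. cell_equiv N (insert (Var n) T) (e(n := x)) (e'(n := x'))"
proof -
  \<comment> \<open>The variable may already occur in \<open>T\<close>. Its old value is about to be
    overwritten, so it is dropped first.\<close>
  define T0 where "T0 = T - {Var n}"
  have T0: "finite T0" "Var n \<notin> T0" "insert (Var n) T0 = insert (Var n) T"
    using \<open>finite T\<close> by (auto simp: T0_def)
  have equiv0: "cell_equiv (2 * N) T0 e e'"
    unfolding T0_def by (rule cell_equiv_remove[OF equiv])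
  have cong: "cell T0 (d(n := z)) S = cell T0 d S" for d z S
  proof (rule cell_cong)
    fix t assume "t \<in> T0"
    then show "val (d(n := z)) t = val d t" using T0(2) by (cases t) auto
  qed
  have "\<exists>x'. \<forall>S\<subseteq>T0.
      tcard N (cell T0 e' S \<inter> atoms_below x') = tcard N (cell T0 e S \<inter> atoms_below x) \<and>
      tcard N (cell T0 e' S - cell T0 e' S \<inter> atoms_below x') =
      tcard N (cell T0 e S - cell T0 e S \<inter> atoms_below x)"
  proof (rule ex_glue_cells[OF T0(1)])
    fix S assume "S \<subseteq> T0"
    let ?X = "cell T0 e S" and ?Y = "cell T0 e' S"
    let ?B = "?X \<inter> atoms_below x"
    obtain B' where B': "B' \<subseteq> ?Y" "tcard N B' = tcard N ?B"
        "tcard N (?Y - B') = tcard N (?X - ?B)" "finite B' \<or> finite (?X - ?B) \<and> finite (?Y - B')"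
      using tcard_split[OF cell_equivD[OF equiv0], of ?B S] by blast
    have atoms: "\<forall>a\<in>?Y. atom a" by (simp add: cell_def)
    have "\<exists>y. atoms_below y = B'"
    proof (cases "finite B'")
      case True
      then show ?thesis using ex_atoms_below_finite atoms B'(1) by (meson subsetD)
    next
      case False
      \<comment> \<open>An infinite answer occurs only if \<open>x\<close> contains all but finitely
        many atoms of the cell. That excludes the unbounded outside cell, so the cell is the atom
        set of an element, from which finitely many atoms are removed.\<close>
      then have fin: "finite (?X - atoms_below x)" "finite (?Y - B')"
        using B'(4) by (auto simp: Diff_Int)
      then have "S \<noteq> {}" using infinite_cell_outside[OF T0(1)] by blast
      then obtain y where y: "atoms_below y = ?Y" using ex_atoms_below_cell T0(1) by blast
      obtain z where z: "atoms_below z = ?Y - B'"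
        using ex_atoms_below_finite[OF fin(2)] atoms by blast
      have "atoms_below (y - z) = B'" using B'(1) y z by auto
      then show ?thesis by blast
    qed
    then show "\<exists>y. atoms_below y \<subseteq> ?Y \<and> tcard N (atoms_below y) = tcard N ?B \<and>
        tcard N (?Y - atoms_below y) = tcard N (?X - ?B)"
      using B' by metis
  qed
  then obtain x' where "\<forall>S\<subseteq>T0.
      tcard N (cell T0 e' S \<inter> atoms_below x') = tcard N (cell T0 e S \<inter> atoms_below x) \<and>
      tcard N (cell T0 e' S - cell T0 e' S \<inter> atoms_below x') =
      tcard N (cell T0 e S - cell T0 e S \<inter> atoms_below x)"
    by blast
  then have "cell_equiv N (insert (Var n) T0) (e(n := x)) (e'(n := x'))"
    by (intro cell_equiv_insert T0) (simp add: cong Diff_Int)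
  then show ?thesis using T0(3) by auto
qed

section \<open>Quantifier rank and preservation of satisfaction\<close>

primrec rank :: "'a fm \<Rightarrow> nat" where
  "rank (Rel s t) = 0"
| "rank (Equal s t) = 0"
| "rank (Neg \<phi>) = rank \<phi>"
| "rank (Conj \<phi> \<psi>) = max (rank \<phi>) (rank \<psi>)"
| "rank (Exists n \<phi>) = Suc (rank \<phi>)"

text \<open>An atom refuting the inequality lies in a cell whose index contains \<open>s\<close> but
  not \<open>t\<close>. The order is therefore read off from which cells are empty.\<close>

lemma val_le_iff_cells:
  assumes "s \<in> T" "t \<in> T"
  shows "val e s \<le> val e t \<longleftrightarrow> (\<forall>S. s \<in> S \<and> t \<notin> S \<longrightarrow> cell T e S = {})"
proof
  assume "val e s \<le> val e t"
  then show "\<forall>S. s \<in> S \<and> t \<notin> S \<longrightarrow> cell T e S = {}"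
    using assms unfolding cell_def by (blast intro: order_trans)
next
  assume empty: "\<forall>S. s \<in> S \<and> t \<notin> S \<longrightarrow> cell T e S = {}"
  have "a \<le> val e t" if "atom a" "a \<le> val e s" for a
  proof (rule ccontr)
    assume "\<not> a \<le> val e t"
    then have "cell T e {r \<in> T. a \<le> val e r} = {}" using empty assms that by simp
    then show False using that(1) by (auto simp: cell_def)
  qed
  then show "val e s \<le> val e t" by (auto simp: le_iff_atoms_below[of "val e s"] atoms_below_def)
qed

lemma trm_mem_if_vars_pars: "Par ` set_trm t \<union> Var ` vars_trm t \<subseteq> T \<Longrightarrow> t \<in> T"
  by (cases t) auto

text \<open>Each quantifier costs one halving of the threshold, through
  \<open>cell_equiv_extend\<close>. At threshold 1, equivalent tuples still have the same empty
  cells, which settles atomic formulas.\<close>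

lemma sat_cong_cell_equiv:
  fixes \<phi> :: "'a::set_mereology fm"
  assumes "finite T" "Par ` set_fm \<phi> \<union> Var ` free_vars \<phi> \<subseteq> T"
    and "cell_equiv (2 ^ rank \<phi>) T e e'"
  shows "sat (\<le>) e \<phi> \<longleftrightarrow> sat (\<le>) e' \<phi>"
  using assms
proof (induction \<phi> arbitrary: T e e')
  have le: "val e s \<le> val e t \<longleftrightarrow> val e' s \<le> val e' t"
    if "s \<in> T" "t \<in> T" "cell_equiv 1 T e e'" for s t T and e e' :: "nat \<Rightarrow> 'a"
  proof -
    have "cell T e S = {} \<longleftrightarrow> cell T e' S = {}" for S
      using cell_equivD[OF that(3), of S] tcard_eq_0_iff[of 1 "cell T e S"]
        tcard_eq_0_iff[of 1 "cell T e' S"] by simp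
    then show ?thesis by (simp add: val_le_iff_cells[OF that(1,2)])
  qed
  {
    case (Rel s t)
    have "s \<in> T" "t \<in> T" by (rule trm_mem_if_vars_pars, use Rel.prems(2) in auto)+
    then show ?case using le Rel.prems(3) by simp
  next
    case (Equal s t)
    have "s \<in> T" "t \<in> T" by (rule trm_mem_if_vars_pars, use Equal.prems(2) in auto)+
    then show ?case using le[of s T t] le[of t T s] Equal.prems(3) by (simp add: order_eq_iff)
  }
next
  case (Neg \<phi>)
  then show ?case by simp
next
  case (Conj \<phi> \<psi>)
  have "cell_equiv (2 ^ rank \<phi>) T e e'" "cell_equiv (2 ^ rank \<psi>) T e e'"
    by (rule cell_equiv_mono[OF Conj.prems(3)], simp add: power_increasing)+
  then show ?case using Conj by (simp add: image_Un)
next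
  case (Exists n \<phi>)
  let ?T = "insert (Var n) T"
  have T: "finite ?T" "Par ` set_fm \<phi> \<union> Var ` free_vars \<phi> \<subseteq> ?T"
    using Exists.prems by auto
  have step: "\<exists>x'. sat (\<le>) (d'(n := x')) \<phi>"
    if sat: "sat (\<le>) (d(n := x)) \<phi>" and equiv: "cell_equiv (2 * 2 ^ rank \<phi>) T d d'" for d d' x
  proof -
    from cell_equiv_extend[OF Exists.prems(1) equiv, of n x]
    obtain x' where "cell_equiv (2 ^ rank \<phi>) ?T (d(n := x)) (d'(n := x'))" ..
    then have "sat (\<le>) (d(n := x)) \<phi> \<longleftrightarrow> sat (\<le>) (d'(n := x')) \<phi>"
      by (rule Exists.IH[OF T])
    with sat show ?thesis by (intro exI[of _ x']) simp
  qed
  show ?case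
  proof -
    have "cell_equiv (2 * 2 ^ rank \<phi>) T e e'" using Exists.prems(3) by simp
    moreover from this have "cell_equiv (2 * 2 ^ rank \<phi>) T e' e" by (rule cell_equiv_sym)
    ultimately show ?thesis unfolding sat.simps by (metis step)
  qed
qed


section \<open>Splitting conditions imply saturation\<close>

text \<open>Cell sizes truncated at \<open>2 ^ n\<close> give each element one of finitely many
  profiles. If every element failed some formula of rank at most \<open>n\<close>, one failing
  formula per profile would form a finite unsatisfiable subset of the type.\<close>

lemma realizes_low_rank:
  fixes p :: "'a::set_mereology fm set"
  assumes "finite A" "one_type_over A p" "finitely_satisfiable (\<le>) p"
  shows "\<exists>x. realizes (\<le>) x {\<phi> \<in> p. rank \<phi> \<le> n}"
proof (rule ccontr)
  assume "\<not> ?thesis"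
  then have "\<forall>x. \<exists>\<phi>. \<phi> \<in> p \<and> rank \<phi> \<le> n \<and> \<not> sat (\<le>) (\<lambda>_. x) \<phi>"
    unfolding realizes_def by blast
  from choice[OF this] obtain g
    where g: "\<And>x. g x \<in> p \<and> rank (g x) \<le> n \<and> \<not> sat (\<le>) (\<lambda>_. x) (g x)"
    by blast
  define T where "T = insert (Var 0) (Par ` A)"
  define prof where "prof x = (\<lambda>S\<in>Pow T. tcard (2 ^ n) (cell T (\<lambda>_. x) S))" for x
  have "finite T" using \<open>finite A\<close> by (simp add: T_def)
  have "range prof \<subseteq> (\<Pi>\<^sub>E S\<in>Pow T. {..2 ^ n})"
    unfolding prof_def by (rule image_subsetI, rule restrict_PiE_iff[THEN iffD2]) (simp add: tcard_le)
  then have "finite (range prof)"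
    by (rule finite_subset) (use \<open>finite T\<close> in \<open>auto intro!: finite_PiE\<close>)
  define q where "q = (\<lambda>k. g (inv prof k)) ` range prof"
  have "finite q" "q \<subseteq> p" using \<open>finite (range prof)\<close> g by (auto simp: q_def)
  then obtain y where y: "realizes (\<le>) y q"
    using assms(3) unfolding finitely_satisfiable_def by blast
  \<comment> \<open>The representative of the profile of \<open>y\<close>: it fails
    \<open>g x\<close>, so \<open>y\<close> fails it too, although \<open>g x\<close> belongs to
    \<open>q\<close>.\<close>
  define x where "x = inv prof (prof y)"
  have prof: "prof x = prof y" by (simp add: x_def f_inv_into_f)
  have "cell_equiv (2 ^ n) T (\<lambda>_. x) (\<lambda>_. y)"
    unfolding cell_equiv_def
  proof (intro allI impI)
    fix S assume "S \<subseteq> T"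
    then show "tcard (2 ^ n) (cell T (\<lambda>_. x) S) = tcard (2 ^ n) (cell T (\<lambda>_. y) S)"
      using fun_cong[OF prof, of S] by (simp add: prof_def)
  qed
  then have "cell_equiv (2 ^ rank (g x)) T (\<lambda>_. x) (\<lambda>_. y)"
    by (rule cell_equiv_mono) (use g in \<open>simp add: power_increasing\<close>)
  moreover have "Par ` set_fm (g x) \<union> Var ` free_vars (g x) \<subseteq> T"
  proof -
    have "set_fm (g x) \<subseteq> A" "free_vars (g x) \<subseteq> {0}"
      using assms(2) g[of x] by (simp_all add: one_type_over_def)
    then show ?thesis unfolding T_def by blast
  qed
  ultimately have "\<not> sat (\<le>) (\<lambda>_. y) (g x)"
    using sat_cong_cell_equiv[OF \<open>finite T\<close>, of "g x" "\<lambda>_. x" "\<lambda>_. y"] g[of x] by simp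
  moreover have "g x \<in> q" by (auto simp: q_def x_def)
  ultimately show False using y by (simp add: realizes_def)
qed

text \<open>The second alternative allows infinite \<open>X j\<close>. For infinite \<open>J\<close>
  it says that the sizes tend to infinity along \<open>J\<close>.\<close>

definition has_limit_size :: "nat set \<Rightarrow> (nat \<Rightarrow> 'a set) \<Rightarrow> bool" where
  "has_limit_size J X \<longleftrightarrow> (\<exists>k. \<forall>j\<in>J. finite (X j) \<and> card (X j) = k)
    \<or> (\<forall>k. finite {j \<in> J. finite (X j) \<and> card (X j) = k})"

lemma has_limit_size_subset: "has_limit_size J X \<Longrightarrow> J' \<subseteq> J \<Longrightarrow> has_limit_size J' X"
  unfolding has_limit_size_def
proof (elim disjE)
  assume "\<exists>k. \<forall>j\<in>J. finite (X j) \<and> card (X j) = k" "J' \<subseteq> J"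
  then have "\<exists>k. \<forall>j\<in>J'. finite (X j) \<and> card (X j) = k"
    by (elim exE, intro exI) (rule ballI, drule (1) subsetD, erule (1) bspec)
  then show "(\<exists>k. \<forall>j\<in>J'. finite (X j) \<and> card (X j) = k) \<or>
      (\<forall>k. finite {j \<in> J'. finite (X j) \<and> card (X j) = k})" ..
next
  assume fin: "\<forall>k. finite {j \<in> J. finite (X j) \<and> card (X j) = k}" and sub: "J' \<subseteq> J"
  have "finite {j \<in> J'. finite (X j) \<and> card (X j) = k}" for k
    by (rule finite_subset[OF _ fin[rule_format, of k]]) (use sub in auto)
  then show "(\<exists>k. \<forall>j\<in>J'. finite (X j) \<and> card (X j) = k) \<or>
      (\<forall>k. finite {j \<in> J'. finite (X j) \<and> card (X j) = k})" by simp
qed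

text \<open>The index set is thinned once for each member of \<open>I\<close>: if some finite size
  occurs infinitely often, keep only those indices. Limit sizes obtained earlier survive
  thinning.\<close>

lemma ex_has_limit_size:
  assumes "finite I"
  shows "\<exists>J. infinite J \<and> (\<forall>i\<in>I. has_limit_size J (X i))"
  using assms
proof (induction I)
  case empty
  show ?case using infinite_UNIV_nat by auto
next
  case (insert i I)
  then obtain J where J: "infinite J" "\<forall>i\<in>I. has_limit_size J (X i)" by blast
  show ?case
  proof (cases "\<exists>k. infinite {j \<in> J. finite (X i j) \<and> card (X i j) = k}")
    case True
    then obtain k where k: "infinite {j \<in> J. finite (X i j) \<and> card (X i j) = k}" by blast
    let ?J = "{j \<in> J. finite (X i j) \<and> card (X i j) = k}"
    have "\<forall>i\<in>I. has_limit_size ?J (X i)"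
      using J(2) has_limit_size_subset[of J _ ?J] by auto
    moreover have "has_limit_size ?J (X i)" by (auto simp: has_limit_size_def)
    ultimately show ?thesis using k by blast
  next
    case False
    then have "has_limit_size J (X i)" by (simp add: has_limit_size_def)
    then show ?thesis using J by blast
  qed
qed

lemma finite_tcard_neq:
  assumes "\<forall>k. finite {j \<in> J. finite (X j) \<and> card (X j) = k}"
  shows "finite {j \<in> J. tcard N (X j) \<noteq> N}"
proof (rule finite_subset)
  show "{j \<in> J. tcard N (X j) \<noteq> N} \<subseteq> (\<Union>k<N. {j \<in> J. finite (X j) \<and> card (X j) = k})"
    by (auto simp: tcard_eq_iff)
qed (use assms in simp)

text \<open>\<open>Y j\<close> is the part of \<open>C\<close> inside the \<open>j\<close>-th approximate realization; the limit \<open>B\<close> can be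
  taken to be one of the \<open>Y j\<close> unless both \<open>Y j\<close> and \<open>C - Y j\<close> grow beyond all bounds.\<close>

lemma ex_limit_of_splittings:
  assumes "infinite J" "\<And>j. Y j \<subseteq> C"
    and "has_limit_size J Y" "has_limit_size J (\<lambda>j. C - Y j)"
    and rep: "\<And>j. R (Y j)"
    and split: "infinite C \<Longrightarrow> \<exists>B\<subseteq>C. R B \<and> infinite B \<and> infinite (C - B)"
  shows "\<exists>B\<subseteq>C. R B \<and> (\<forall>N. finite {j \<in> J. \<not>
    (tcard N (Y j) = tcard N B \<and> tcard N (C - Y j) = tcard N (C - B))})"
proof -
  obtain i where i: "i \<in> J" using \<open>infinite J\<close> by fastforce
  have compl: "tcard N (C - V) = tcard N (C - W)"
    if "finite V" "finite W" "card V = card W" "V \<subseteq> C" "W \<subseteq> C" for N V W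
    using that by (auto simp: tcard_def card_Diff_subset)
  consider (inside) "\<exists>k. \<forall>j\<in>J. finite (Y j) \<and> card (Y j) = k"
    | (outside) "\<exists>k. \<forall>j\<in>J. finite (C - Y j) \<and> card (C - Y j) = k"
    | (both) "\<forall>k. finite {j \<in> J. finite (Y j) \<and> card (Y j) = k}"
        "\<forall>k. finite {j \<in> J. finite (C - Y j) \<and> card (C - Y j) = k}"
    using assms(3,4) unfolding has_limit_size_def by argo
  then show ?thesis
  proof cases
    case inside
    then obtain k where k: "\<And>j. j \<in> J \<Longrightarrow> finite (Y j)" "\<And>j. j \<in> J \<Longrightarrow> card (Y j) = k"
      by auto
    have "tcard N (Y j) = tcard N (Y i)" "tcard N (C - Y j) = tcard N (C - Y i)"
      if "j \<in> J" for N j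
      using compl[OF k(1)[OF that] k(1)[OF i] _ assms(2) assms(2), of N] k(1,2)[OF that] k(1,2)[OF i]
      by (simp_all add: tcard_def)
    then show ?thesis
      using rep[of i] assms(2)[of i] by (intro exI[of _ "Y i"]) (simp cong: conj_cong)
  next
    case outside
    then obtain k
      where k: "\<And>j. j \<in> J \<Longrightarrow> finite (C - Y j)" "\<And>j. j \<in> J \<Longrightarrow> card (C - Y j) = k"
      by auto
    have "C - (C - Y j) = Y j" for j using assms(2)[of j] by blast
    then have "tcard N (Y j) = tcard N (Y i)" "tcard N (C - Y j) = tcard N (C - Y i)"
      if "j \<in> J" for N j
      using compl[OF k(1)[OF that] k(1)[OF i] _ Diff_subset Diff_subset, of N]
        k(1,2)[OF that] k(1,2)[OF i]
      by (simp_all add: tcard_def)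
    then show ?thesis
      using rep[of i] assms(2)[of i] by (intro exI[of _ "Y i"]) (simp cong: conj_cong)
  next
    case both
    \<comment> \<open>In a finite \<open>C\<close> no \<open>Y j\<close> could reach size
      \<open>Suc (card C)\<close>, whereas unbounded growth makes almost all of them do so.\<close>
    have "infinite C"
    proof
      assume fin: "finite C"
      have "finite {j \<in> J. tcard (Suc (card C)) (Y j) \<noteq> Suc (card C)}"
        by (rule finite_tcard_neq[OF both(1)])
      moreover have "tcard (Suc (card C)) (Y j) \<noteq> Suc (card C)" for j
        using fin assms(2)[of j] card_mono[of C "Y j"] finite_subset[of "Y j" C]
        by (auto simp: tcard_eq_iff)
      ultimately show False using \<open>infinite J\<close> by simp
    qed
    then obtain B where B: "B \<subseteq> C" "R B" "infinite B" "infinite (C - B)"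
      using split by blast
    \<comment> \<open>Both parts cut out by \<open>B\<close> have truncated size \<open>N\<close>,
      and so do both parts cut out by \<open>Y j\<close> for almost all \<open>j\<close>.\<close>
    have "finite {j \<in> J. \<not> (tcard N (Y j) = tcard N B \<and> tcard N (C - Y j) = tcard N (C - B))}"
      for N
      by (rule finite_subset[OF _ finite_UnI[OF finite_tcard_neq[OF both(1), of N]
              finite_tcard_neq[OF both(2), of N]]])
        (use B in \<open>auto simp: tcard_def\<close>)
    then show ?thesis using B by blast
  qed
qed

lemma omega_saturated_if_splittings:
  assumes split: "\<And>u::'a::set_mereology. infinite_elem u \<Longrightarrow>
      \<exists>x y. infinite_elem x \<and> infinite_elem y \<and> disjoint_elem x y \<and> u = sup x y"
    and outside: "\<And>a::'a. \<exists>u. infinite_elem u \<and> disjoint_elem u a"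
  shows "omega_saturated ((\<le>) :: 'a \<Rightarrow> 'a \<Rightarrow> bool)"
  unfolding omega_saturated_def
proof (intro allI impI, elim conjE)
  fix A :: "'a set" and p
  assume A: "finite A" "one_type_over A p" "finitely_satisfiable (\<le>) p"
  obtain x where x: "\<And>n. realizes (\<le>) (x n) {\<phi> \<in> p. rank \<phi> \<le> n}"
    using realizes_low_rank[OF A] by metis
  define T :: "'a trm set" where "T = Par ` A"
  have T: "finite T" "Var 0 \<notin> T" using A(1) by (auto simp: T_def)
  \<comment> \<open>All terms in \<open>T\<close> are parameters, so the assignment is irrelevant
    and \<open>bot\<close> is a dummy value.\<close>
  define C where "C S = cell T (\<lambda>_. bot) S" for S
  have C: "cell T (\<lambda>_. z) S = C S" for z S
    unfolding C_def by (rule cell_cong) (auto simp: T_def)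
  define Y where "Y S j = C S \<inter> atoms_below (x j)" for S j
  define agree where "agree S B N j \<longleftrightarrow>
    tcard N (Y S j) = tcard N B \<and> tcard N (C S - Y S j) = tcard N (C S - B)" for S B N j
  \<comment> \<open>The Boolean index selects the inside or the outside part of a cell, so that a
    single \<open>J\<close> serves both.\<close>
  have "\<exists>J. infinite J \<and> (\<forall>i\<in>Pow T \<times> UNIV. has_limit_size J
      (\<lambda>j. if snd i then Y (fst i) j else C (fst i) - Y (fst i) j))"
    by (rule ex_has_limit_size) (use T in auto)
  then obtain J where J: "infinite J" and lim: "\<forall>i\<in>Pow T \<times> UNIV. has_limit_size J
      (\<lambda>j. if snd i then Y (fst i) j else C (fst i) - Y (fst i) j)"
    by (elim exE conjE)
  have "\<exists>y. \<forall>S\<subseteq>T. \<forall>N. finite {j \<in> J. \<not> agree S (cell T (\<lambda>_. bot) S \<inter> atoms_below y) N j}"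
  proof (rule ex_glue_cells[OF T(1), where P = "\<lambda>S B. \<forall>N. finite {j \<in> J. \<not> agree S B N j}"])
    fix S assume S: "S \<subseteq> T"
    have "\<exists>B\<subseteq>C S. (\<exists>y. atoms_below y = B) \<and> (\<forall>N. finite {j \<in> J. \<not> agree S B N j})"
      unfolding agree_def
    proof (rule ex_limit_of_splittings[OF J])
      show "Y S j \<subseteq> C S" for j by (simp add: Y_def)
      show "has_limit_size J (Y S)" using lim[rule_format, of "(S, True)"] S by simp
      show "has_limit_size J (\<lambda>j. C S - Y S j)" using lim[rule_format, of "(S, False)"] S by simp
      show "\<exists>y. atoms_below y = Y S j" for j
        unfolding C_def Y_def by (rule ex_atoms_below_cell_Int[OF T(1)])
      show "\<exists>B\<subseteq>C S. (\<exists>y. atoms_below y = B) \<and> infinite B \<and> infinite (C S - B)"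
        if inf: "infinite (C S)"
      proof (cases "S = {}")
        case True
        \<comment> \<open>The outside cell is not bounded by an element. Condition (2), applied to
          the join \<open>a\<close> of all parameters, provides an infinite part of it, and
          infinitely many atoms remain beyond that part.\<close>
        obtain a where a: "atoms_below a = (\<Union>t\<in>T. atoms_below (val (\<lambda>_. bot) t))"
          using ex_atoms_below_UN[OF T(1), of "\<lambda>t. atoms_below (val (\<lambda>_. bot) t)"] by blast
        obtain u where u: "infinite_elem u" "disjoint_elem u a" using outside by blast
        then have "atoms_below u \<inter> (\<Union>t\<in>T. atoms_below (val (\<lambda>_. bot) t)) = {}"
          by (simp add: disjoint_elem_iff a)
        then have "atoms_below u \<subseteq> C S"
          by (auto simp: True C_def cell_def atoms_below_def)
        moreover have "infinite (C S - atoms_below u)"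
          unfolding True C_def by (rule infinite_cell_outside[OF T(1)])
        ultimately show ?thesis using u(1) by (auto simp: infinite_elem_iff)
      next
        case False
        \<comment> \<open>Every other cell is the atom set of an element, to which condition (1)
          applies.\<close>
        then obtain c where c: "atoms_below c = C S"
          using ex_atoms_below_cell[OF T(1)] unfolding C_def by blast
        then have "infinite_elem c" using inf by (simp add: infinite_elem_iff)
        from split[OF this] obtain y z
          where yz: "infinite_elem y" "infinite_elem z" "disjoint_elem y z" "c = sup y z"
          by blast
        then have "C S - atoms_below y = atoms_below z"
          unfolding c[symmetric] by (auto simp: disjoint_elem_iff)
        moreover have "atoms_below y \<subseteq> C S" using yz(4) c by auto
        ultimately show ?thesis using yz(1,2) by (auto simp: infinite_elem_iff)
      qed
    qed
    then obtain y where "atoms_below y \<subseteq> C S" "\<forall>N. finite {j \<in> J. \<not> agree S (atoms_below y) N j}"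
      by auto
    then show "\<exists>y. atoms_below y \<subseteq> cell T (\<lambda>_. bot) S \<and>
        (\<forall>N. finite {j \<in> J. \<not> agree S (atoms_below y) N j})"
      unfolding C_def by (intro exI[of _ y] conjI)
  qed
  then obtain y where y: "\<And>S N. S \<subseteq> T \<Longrightarrow>
      finite {j \<in> J. \<not> agree S (C S \<inter> atoms_below y) N j}"
    unfolding C_def[symmetric] by auto
  have "sat (\<le>) (\<lambda>_. y) \<phi>" if "\<phi> \<in> p" for \<phi>
  proof -
    let ?N = "2 ^ rank \<phi>"
    let ?bad = "\<lambda>S. {j \<in> J. \<not> agree S (C S \<inter> atoms_below y) ?N j}"
    \<comment> \<open>There are finitely many cells, each with finitely many bad indices. Some
      \<open>j\<close> in \<open>J\<close> thus agrees with \<open>y\<close> on all cells and is at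
      least the rank, so that \<open>x j\<close> satisfies the formula.\<close>
    have "finite ((\<Union>S\<in>Pow T. ?bad S) \<union> {..<rank \<phi>})" using y T(1) by simp
    then have "\<not> J \<subseteq> (\<Union>S\<in>Pow T. ?bad S) \<union> {..<rank \<phi>}"
      using J finite_subset by blast
    then obtain j where j: "j \<in> J" "\<And>S. S \<subseteq> T \<Longrightarrow> agree S (C S \<inter> atoms_below y) ?N j"
        "rank \<phi> \<le> j"
      by (auto simp: subset_iff not_less)
    have equiv: "cell_equiv ?N (insert (Var 0) T) (\<lambda>_. x j) (\<lambda>_. y)"
      by (rule cell_equiv_insert[OF T]) (use j(2) in \<open>simp add: C agree_def Y_def Diff_Int\<close>)
    have "set_fm \<phi> \<subseteq> A" "free_vars \<phi> \<subseteq> {0}"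
      using A(2) that by (simp_all add: one_type_over_def)
    then have "Par ` set_fm \<phi> \<union> Var ` free_vars \<phi> \<subseteq> insert (Var 0) T"
      unfolding T_def by blast
    moreover have "sat (\<le>) (\<lambda>_. x j) \<phi>"
      using x[of j] that j(3) by (auto simp: realizes_def)
    ultimately show ?thesis
      using sat_cong_cell_equiv[OF _ _ equiv] T(1) by simp
  qed
  then show "\<exists>x. realizes (\<le>) x p" by (auto simp: realizes_def)
qed


section \<open>Saturation implies the splitting conditions\<close>

text \<open>Existence of a strict chain of length \<open>n\<close> from the parameter up to \<open>Var i\<close>, respectively from
  \<open>Var i\<close> up to the parameter: a first-order way to say that the difference has at least \<open>n\<close> atoms.\<close>

primrec chain_above :: "'a \<Rightarrow> nat \<Rightarrow> nat \<Rightarrow> 'a fm" where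
  "chain_above a 0 i = Rel (Par a) (Var i)"
| "chain_above a (Suc n) i = Exists (Suc i)
    (Conj (Conj (Rel (Var (Suc i)) (Var i)) (Neg (Equal (Var (Suc i)) (Var i))))
      (chain_above a n (Suc i)))"

primrec chain_below :: "'a \<Rightarrow> nat \<Rightarrow> nat \<Rightarrow> 'a fm" where
  "chain_below a 0 i = Rel (Var i) (Par a)"
| "chain_below a (Suc n) i = Exists (Suc i)
    (Conj (Conj (Rel (Var i) (Var (Suc i))) (Neg (Equal (Var i) (Var (Suc i)))))
      (chain_below a n (Suc i)))"

lemma chain_above_params [simp]:
  "set_fm (chain_above a n i) = {a}" "free_vars (chain_above a n i) = {i}"
  by (induction n arbitrary: i) auto

lemma chain_below_params [simp]:
  "set_fm (chain_below a n i) = {a}" "free_vars (chain_below a n i) = {i}"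
  by (induction n arbitrary: i) auto

text \<open>Each strict step down towards \<open>a\<close> loses at least one atom outside
  \<open>a\<close>, and removing a single such atom is a permitted step. The length of a chain thus
  counts the atoms of the difference.\<close>

lemma sat_chain_above:
  fixes a :: "'a::set_mereology"
  shows "sat (\<le>) e (chain_above a n i) \<longleftrightarrow>
    a \<le> e i \<and> (finite (atoms_below (e i - a)) \<longrightarrow> n \<le> card (atoms_below (e i - a)))"
proof (induction n arbitrary: e i)
  case 0
  show ?case by simp
next
  case (Suc n)
  let ?x = "e i"
  let ?P = "\<lambda>n x. a \<le> x \<and> (finite (atoms_below (x - a)) \<longrightarrow> n \<le> card (atoms_below (x - a)))"
  have "sat (\<le>) e (chain_above a (Suc n) i) \<longleftrightarrow> (\<exists>y<?x. ?P n y)"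
    using Suc.IH by (auto simp: less_le)
  also have "\<dots> \<longleftrightarrow> ?P (Suc n) ?x"
  proof
    assume "\<exists>y<?x. ?P n y"
    then obtain y where y: "y < ?x" "?P n y" by blast
    then have sub: "atoms_below (y - a) \<subset> atoms_below (?x - a)"
      by (auto simp: less_iff_atoms_below le_iff_atoms_below)
    then show "?P (Suc n) ?x"
      using y psubset_card_mono[OF _ sub] finite_subset[of "atoms_below (y - a)"]
      by (fastforce simp del: atoms_below_diff)
  next
    assume P: "?P (Suc n) ?x"
    then have "atoms_below (?x - a) \<noteq> {}" by (auto simp del: atoms_below_diff)
    then obtain b where b: "b \<in> atoms_below ?x - atoms_below a" by auto
    then have eq: "atoms_below (?x - b) = atoms_below ?x - {b}"
      by (simp add: atoms_below_atom atoms_below_def[of "e i"])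
    have diff: "atoms_below (?x - b - a) = atoms_below (?x - a) - {b}"
      unfolding atoms_below_diff[of "?x - b"] eq by auto
    have "?x - b < ?x" "a \<le> ?x - b"
      using P b eq by (auto simp: less_iff_atoms_below le_iff_atoms_below[of a] simp del: atoms_below_diff)
    moreover have "finite (atoms_below (?x - b - a)) \<longrightarrow> n \<le> card (atoms_below (?x - b - a))"
      using P b unfolding diff by (auto simp: card_Diff_singleton)
    ultimately show "\<exists>y<?x. ?P n y" by blast
  qed
  finally show ?case .
qed

text \<open>The mirror image: each strict step up towards \<open>a\<close> gains at least one atom
  of \<open>a\<close>, and adding a single atom is a permitted step.\<close>

lemma sat_chain_below:
  fixes a :: "'a::set_mereology"
  shows "sat (\<le>) e (chain_below a n i) \<longleftrightarrow>
    e i \<le> a \<and> (finite (atoms_below (a - e i)) \<longrightarrow> n \<le> card (atoms_below (a - e i)))"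
proof (induction n arbitrary: e i)
  case 0
  show ?case by simp
next
  case (Suc n)
  let ?x = "e i"
  let ?P = "\<lambda>n x. x \<le> a \<and> (finite (atoms_below (a - x)) \<longrightarrow> n \<le> card (atoms_below (a - x)))"
  have "sat (\<le>) e (chain_below a (Suc n) i) \<longleftrightarrow> (\<exists>y>?x. ?P n y)"
    using Suc.IH by (auto simp: less_le)
  also have "\<dots> \<longleftrightarrow> ?P (Suc n) ?x"
  proof
    assume "\<exists>y>?x. ?P n y"
    then obtain y where y: "y > ?x" "?P n y" by blast
    then have sub: "atoms_below (a - y) \<subset> atoms_below (a - ?x)"
      by (auto simp: less_iff_atoms_below le_iff_atoms_below)
    then show "?P (Suc n) ?x"
      using y psubset_card_mono[OF _ sub] finite_subset[of "atoms_below (a - y)"]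
      by (fastforce simp del: atoms_below_diff)
  next
    assume P: "?P (Suc n) ?x"
    then have "atoms_below (a - ?x) \<noteq> {}" by (auto simp del: atoms_below_diff)
    then obtain b where b: "b \<in> atoms_below a - atoms_below ?x" by auto
    then have eq: "atoms_below (sup ?x b) = insert b (atoms_below ?x)"
      by (simp add: atoms_below_atom atoms_below_def[of a])
    have diff: "atoms_below (a - sup ?x b) = atoms_below (a - ?x) - {b}"
      unfolding atoms_below_diff eq by auto
    have "?x < sup ?x b" "sup ?x b \<le> a"
      using P b eq by (auto simp: less_iff_atoms_below le_iff_atoms_below[of _ a] simp del: atoms_below_sup)
    moreover have "finite (atoms_below (a - sup ?x b)) \<longrightarrow> n \<le> card (atoms_below (a - sup ?x b))"
      using P b unfolding diff by (auto simp: card_Diff_singleton)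
    ultimately show "\<exists>y>?x. ?P n y" by blast
  qed
  finally show ?case .
qed

text \<open>A finite part of the sequence lies in an initial segment, so satisfying initial segments
  gives finite satisfiability.\<close>

lemma omega_saturated_sequence:
  assumes "omega_saturated R" "finite A"
    and "\<And>n. set_fm (\<phi> n) \<subseteq> A \<and> free_vars (\<phi> n) \<subseteq> {0::nat}"
    and sat: "\<And>N::nat. \<exists>x. \<forall>n\<le>N. sat R (\<lambda>_. x) (\<phi> n)"
  shows "\<exists>x. \<forall>n. sat R (\<lambda>_. x) (\<phi> n)"
proof -
  have "\<exists>x. realizes R x q" if q: "finite q" "q \<subseteq> range \<phi>" for q
  proof -
    obtain K where K: "finite K" "q = \<phi> ` K" using finite_subset_image[OF q] by blast
    then obtain N where "\<forall>n\<in>K. n \<le> N" using finite_nat_set_iff_bounded_le by blast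
    then show ?thesis using sat[of N] K(2) by (auto simp: realizes_def)
  qed
  then have "finitely_satisfiable R (range \<phi>)" by (simp add: finitely_satisfiable_def)
  moreover have "one_type_over A (range \<phi>)" using assms(3) by (auto simp: one_type_over_def)
  ultimately show ?thesis
    using assms(1,2) unfolding omega_saturated_def realizes_def by (meson rangeI)
qed

lemma ex_splitting_if_omega_saturated:
  fixes u :: "'a::set_mereology"
  assumes "omega_saturated ((\<le>) :: 'a \<Rightarrow> 'a \<Rightarrow> bool)" "infinite_elem u"
  shows "\<exists>x y. infinite_elem x \<and> infinite_elem y \<and> disjoint_elem x y \<and> u = sup x y"
proof -
  have inf: "infinite (atoms_below u)" using assms(2) by (simp add: infinite_elem_iff)
  let ?\<phi> = "\<lambda>n. Conj (chain_above bot n 0) (chain_below u n 0)"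
  have "\<exists>x. \<forall>n. sat (\<le>) (\<lambda>_. x) (?\<phi> n)"
  proof (rule omega_saturated_sequence[OF assms(1), of "{bot, u}"])
    fix N
    \<comment> \<open>Any \<open>N\<close> atoms of \<open>u\<close> approximate the type up to
      \<open>N\<close>, since infinitely many atoms of \<open>u\<close> remain.\<close>
    obtain F where F: "F \<subseteq> atoms_below u" "finite F" "card F = N"
      using infinite_arbitrarily_large[OF inf] by blast
    then have "\<forall>a\<in>F. atom a" by (auto simp: atoms_below_def)
    then obtain x where "atoms_below x = F" using ex_atoms_below_finite F(2) by blast
    then have "\<forall>n\<le>N. sat (\<le>) (\<lambda>_. x) (?\<phi> n)"
      using F inf by (simp add: sat_chain_above sat_chain_below le_iff_atoms_below[of x])
    then show "\<exists>x. \<forall>n\<le>N. sat (\<le>) (\<lambda>_. x) (?\<phi> n)" by blast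
  qed auto
  then obtain x where x: "x \<le> u" "\<And>n. finite (atoms_below x) \<Longrightarrow> n \<le> card (atoms_below x)"
      "\<And>n. finite (atoms_below u - atoms_below x) \<Longrightarrow> n \<le> card (atoms_below u - atoms_below x)"
    by (auto simp: sat_chain_above sat_chain_below)
  \<comment> \<open>A finite cardinality cannot be at least every natural number.\<close>
  have "infinite_elem x" "infinite_elem (u - x)"
    using x(2,3) not_less_eq_eq by (auto simp: infinite_elem_iff)
  moreover have "disjoint_elem x (u - x)" by (auto simp: disjoint_elem_iff)
  moreover have "u = sup x (u - x)"
    using x(1) by (auto simp: eq_iff_atoms_below le_iff_atoms_below)
  ultimately show ?thesis by blast
qed

lemma ex_disjoint_infinite_if_omega_saturated:
  fixes a :: "'a::set_mereology"
  assumes "omega_saturated ((\<le>) :: 'a \<Rightarrow> 'a \<Rightarrow> bool)"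
  shows "\<exists>u. infinite_elem u \<and> disjoint_elem u a"
proof -
  have "\<exists>x. \<forall>n. sat (\<le>) (\<lambda>_. x) (chain_above a n 0)"
  proof (rule omega_saturated_sequence[OF assms, of "{a}"])
    fix N
    obtain F where F: "F \<subseteq> {a. atom a} - atoms_below a" "finite F" "card F = N"
      using infinite_arbitrarily_large[OF infinite_atoms_outside] by blast
    then obtain y where y: "atoms_below y = F" using ex_atoms_below_finite[of F] by blast
    then have "atoms_below (sup a y) - atoms_below a = F" using F(1) by auto
    then have "\<forall>n\<le>N. sat (\<le>) (\<lambda>_. sup a y) (chain_above a n 0)"
      using F(3) by (simp add: sat_chain_above del: atoms_below_sup)
    then show "\<exists>x. \<forall>n\<le>N. sat (\<le>) (\<lambda>_. x) (chain_above a n 0)" by blast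
  qed auto
  then obtain x where "\<And>n. finite (atoms_below (x - a)) \<Longrightarrow> n \<le> card (atoms_below (x - a))"
    unfolding sat_chain_above by blast
  then have "infinite_elem (x - a)"
    using not_less_eq_eq unfolding infinite_elem_iff by blast
  moreover have "disjoint_elem (x - a) a" by (simp add: disjoint_elem_def inf_diff)
  ultimately show ?thesis by blast
qed

text \<open>Given a splitting of \<open>u\<close> into \<open>y\<close> and \<open>z\<close> and an
  infinite \<open>w\<close> disjoint from \<open>u\<close>, the join of \<open>y\<close> and
  \<open>w\<close> overlaps \<open>u\<close> as required. Conversely, such an \<open>x\<close>
  splits \<open>u\<close> into \<open>inf u x\<close> and \<open>u - x\<close>.\<close>

lemma splittings_iff_overlap:
  "(\<forall>u::'a::set_mereology. infinite_elem u \<longrightarrow>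
      (\<exists>x y. infinite_elem x \<and> infinite_elem y \<and> disjoint_elem x y \<and> u = sup x y))
    \<and> (\<forall>a::'a. \<exists>u. infinite_elem u \<and> disjoint_elem u a)
   \<longleftrightarrow> (\<exists>u::'a. infinite_elem u)
    \<and> (\<forall>u::'a. infinite_elem u \<longrightarrow>
        (\<exists>x. infinite_elem (u - x) \<and> infinite_elem (inf u x) \<and> infinite_elem (x - u)))"
  (is "?split \<and> ?outside \<longleftrightarrow> ?inf \<and> ?overlap")
proof
  assume L: "?split \<and> ?outside"
  have "\<exists>x. infinite_elem (u - x) \<and> infinite_elem (inf u x) \<and> infinite_elem (x - u)"
    if u: "infinite_elem u" for u :: 'a
  proof -
    obtain y z where yz: "infinite_elem y" "infinite_elem z" "disjoint_elem y z" "u = sup y z"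
      using L u by blast
    obtain w where w: "infinite_elem w" "disjoint_elem w u" using L by blast
    let ?x = "sup y w"
    have "u - ?x = z" "inf u ?x = y" "?x - u = w"
      using yz(3,4) w(2) by (auto simp: eq_iff_atoms_below disjoint_elem_iff)
    then show ?thesis using yz w by metis
  qed
  then show "?inf \<and> ?overlap" using L by blast
next
  assume R: "?inf \<and> ?overlap"
  have "\<exists>x y. infinite_elem x \<and> infinite_elem y \<and> disjoint_elem x y \<and> u = sup x y"
    if u: "infinite_elem u" for u :: 'a
  proof -
    obtain x where "infinite_elem (u - x)" "infinite_elem (inf u x)" using R u by blast
    moreover have "disjoint_elem (inf u x) (u - x)" by (auto simp: disjoint_elem_iff)
    ultimately show ?thesis using sup_diff[of u x] by metis
  qed
  moreover have "\<exists>u. infinite_elem u \<and> disjoint_elem u a" for a :: 'a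
  proof -
    obtain v :: 'a where "infinite_elem v" using R by blast
    \<comment> \<open>The overlap condition speaks only of infinite elements, so a possibly finite
      \<open>a\<close> is first enlarged by \<open>v\<close>.\<close>
    then have "infinite_elem (sup a v)" by (simp add: infinite_elem_iff)
    then obtain x where x: "infinite_elem (x - sup a v)" using R by blast
    have "disjoint_elem (x - sup a v) a" by (auto simp: disjoint_elem_iff)
    then show ?thesis using x by blast
  qed
  ultimately show "?split \<and> ?outside" by blast
qed

theorem theorem4:
  shows "(omega_saturated ((\<le>) :: 'a::set_mereology \<Rightarrow> 'a \<Rightarrow> bool) \<longleftrightarrow>
            (\<forall>u::'a. infinite_elem u \<longrightarrow>
               (\<exists>x y. infinite_elem x \<and> infinite_elem y \<and> disjoint_elem x y \<and> u = sup x y))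
          \<and> (\<forall>a::'a. \<exists>u. infinite_elem u \<and> disjoint_elem u a))
       \<and> (omega_saturated ((\<le>) :: 'a::set_mereology \<Rightarrow> 'a \<Rightarrow> bool) \<longleftrightarrow>
            (\<exists>u::'a. infinite_elem u)
          \<and> (\<forall>u::'a. infinite_elem u \<longrightarrow>
               (\<exists>x. infinite_elem (u - x) \<and> infinite_elem (inf u x) \<and> infinite_elem (x - u))))"
  unfolding splittings_iff_overlap[symmetric]
  using omega_saturated_if_splittings ex_splitting_if_omega_saturated
    ex_disjoint_infinite_if_omega_saturated
  by blast

end
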